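(* For words $u,v \in \mathcal{X}^*$ over an alphabet of variables $\mathcal{X}$, the identity $u \approx v$ is satisfied by the meet-stalactic monoid $\mathrm{mSt}$ if and only if it is balanced, $\overrightarrow{\rho_u} = \overrightarrow{\rho_v}$ and $\overleftarrow{\rho_{u}} = \overleftarrow{\rho_{v}}$.
   Context: For a word $w$ over an alphabet, $|w|_x$ is the number of occurrences of $x$ in $w$ and $\mathrm{supp}(w)$ is the set of letters occurring in $w$. $\overrightarrow{\rho_w}$ (resp. $\overleftarrow{\rho_w}$) is the bijection $\mathrm{supp}(w)\to\{1,\dots,|\mathrm{supp}(w)|\}$ sending a letter to its rank when the letters of $w$ are ordered by the position of their first (resp. last) occurrence, reading $w$ from left to right. With $\mathbb{N}=\{1,2,\dots\}$, the meet-stalactic monoid is $\mathrm{mSt}=\mathbb{N}^*/{\equiv_{\mathrm{mSt}}}$, where $u\equiv_{\mathrm{mSt}}v$ iff $|u|_x=|v|_x$ for every $x\in\mathbb{N}$, $\overrightarrow{\rho_u}=\overrightarrow{\rho_v}$ and $\overleftarrow{\rho_u}=\overleftarrow{\rho_v}$ (this is the intersection of the left-stalactic and right-stalactic congruences). A monoid $M$ satisfies the identity $u\approx v$ (with $u,v\in\mathcal{X}^*$) if $\psi(u)=\psi(v)$ for every monoid morphism $\psi:\mathcal{X}^*\to M$. The identity $u\approx v$ is balanced if $|u|_x=|v|_x$ for every $x\in\mathcal{X}$. *)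

theory Defs
  imports "HOL-Algebra.Coset"
begin

definition first_pos :: "'a list \<Rightarrow> 'a \<Rightarrow> nat" where
  "first_pos w x = Min {i. i < length w \<and> w ! i = x}"

definition last_pos :: "'a list \<Rightarrow> 'a \<Rightarrow> nat" where
  "last_pos w x = Max {i. i < length w \<and> w ! i = x}"

text \<open>The ranking bijections are partial maps with domain the support \<open>set w\<close>, so that equality of two
  of them includes equality of the supports. Ranks start at 1.\<close>

definition rho_first :: "'a list \<Rightarrow> 'a \<rightharpoonup> nat" where
  "rho_first w = (\<lambda>x. if x \<in> set w
     then Some (card {y \<in> set w. first_pos w y \<le> first_pos w x}) else None)"

definition rho_last :: "'a list \<Rightarrow> 'a \<rightharpoonup> nat" where
  "rho_last w = (\<lambda>x. if x \<in> set w
     then Some (card {y \<in> set w. last_pos w y \<le> last_pos w x}) else None)"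

definition free_monoid :: "'a set \<Rightarrow> 'a list monoid" where
  "free_monoid A = \<lparr>carrier = lists A, mult = (@), one = []\<rparr>"

definition quotient_monoid :: "('a, 'm) monoid_scheme \<Rightarrow> ('a \<times> 'a) set \<Rightarrow> 'a set monoid" where
  "quotient_monoid M r =
     \<lparr>carrier = carrier M // r, mult = (\<lambda>A B. r `` (A <#>\<^bsub>M\<^esub> B)), one = r `` {\<one>\<^bsub>M\<^esub>}\<rparr>"

text \<open>The library's \<^const>\<open>hom\<close> does not require the identity to be preserved.\<close>

definition monoid_homs :: "('a, 'm) monoid_scheme \<Rightarrow> ('b, 'n) monoid_scheme \<Rightarrow> ('a \<Rightarrow> 'b) set" where
  "monoid_homs M N = {h \<in> hom M N. h \<one>\<^bsub>M\<^esub> = \<one>\<^bsub>N\<^esub>}"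

text \<open>The alphabet of the stalactic monoids is the set of positive integers.\<close>

definition mSt_cong :: "(nat list \<times> nat list) set" where
  "mSt_cong = {(u, v). u \<in> lists {1..} \<and> v \<in> lists {1..}
     \<and> (\<forall>x \<in> {1..}. count_list u x = count_list v x)
     \<and> rho_first u = rho_first v \<and> rho_last u = rho_last v}"

definition mSt :: "nat list set monoid" where
  "mSt = quotient_monoid (free_monoid {1..}) mSt_cong"

definition satisfies_identity ::
    "('b, 'n) monoid_scheme \<Rightarrow> 'x set \<Rightarrow> 'x list \<Rightarrow> 'x list \<Rightarrow> bool" where
  "satisfies_identity M X u v \<longleftrightarrow> (\<forall>\<psi> \<in> monoid_homs (free_monoid X) M. \<psi> u = \<psi> v)"

definition balanced :: "'x set \<Rightarrow> 'x list \<Rightarrow> 'x list \<Rightarrow> bool" where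
  "balanced X u v \<longleftrightarrow> (\<forall>x \<in> X. count_list u x = count_list v x)"

end

theory Submission
  imports Defs "HOL-Library.Multiset"
begin

text \<open>The list \<^term>\<open>remdups w\<close> enumerates the letters of \<open>w\<close> by last occurrence, and
  \<^term>\<open>rev (remdups (rev w))\<close> enumerates them by first occurrence; the rank functions and these
  lists determine each other. For a substitution \<open>g\<close> of words for letters, the word
  \<open>remdups (concat (map g w))\<close> depends only on \<^term>\<open>remdups w\<close>, because a letter that occurs
  again later contributes no last occurrences. Hence words that agree in content and in both orders
  have congruent images under every morphism into the monoid. Conversely, renaming the finitely many
  variables of the two words injectively by positive integers is a morphism that separates them.\<close>

section \<open>Rank functions\<close>

text \<open>Along \<open>d\<close> the order of the values of \<open>p\<close> is the order of the
  indices, so the counted set is the injective image of \<open>{..i}\<close>.\<close>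

lemma card_le_nth_strictly_sorted:
  fixes p :: "'a \<Rightarrow> 'b::linorder"
  assumes sorted: "sorted_wrt (\<lambda>x y. p x < p y) d" and i: "i < length d"
  shows "card {y \<in> set d. p y \<le> p (d ! i)} = Suc i"
proof -
  have less: "p (d ! j) < p (d ! k)" if "j < k" "k < length d" for j k
    using sorted that by (rule sorted_wrt_nth_less)
  have le_iff: "p (d ! j) \<le> p (d ! i) \<longleftrightarrow> j \<le> i" if "j < length d" for j
    using less[of j i] less[of i j] i that by (cases j i rule: linorder_cases) auto
  have "{y \<in> set d. p y \<le> p (d ! i)} = (!) d ` {..i}"
  proof (intro equalityI subsetI)
    fix y assume y: "y \<in> {y \<in> set d. p y \<le> p (d ! i)}"
    then obtain j where j: "j < length d" "d ! j = y"
      by (auto simp: in_set_conv_nth)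
    with y le_iff[of j] have "j \<in> {..i}"
      by simp
    with j show "y \<in> (!) d ` {..i}"
      by blast
  next
    fix y assume "y \<in> (!) d ` {..i}"
    then obtain j where j: "j \<le> i" "y = d ! j"
      by blast
    with i le_iff[of j] show "y \<in> {y \<in> set d. p y \<le> p (d ! i)}"
      by simp
  qed
  moreover have "inj_on ((!) d) {..i}"
  proof (rule inj_onI)
    fix j k assume "j \<in> {..i}" "k \<in> {..i}" "d ! j = d ! k"
    then show "j = k"
      using less[of j k] less[of k j] i by (cases j k rule: linorder_cases) auto
  qed
  ultimately show ?thesis
    by (simp add: card_image)
qed

text \<open>The rank map is the inverse of indexing into \<open>d\<close>; \<open>Suc\<close>
  appears because ranks start at 1 and indices at 0.\<close>

lemma rank_eq_Some_iff:
  fixes p :: "'a \<Rightarrow> 'b::linorder"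
  assumes sorted: "sorted_wrt (\<lambda>x y. p x < p y) d" and A: "set d = A"
  shows "(if x \<in> A then Some (card {y \<in> A. p y \<le> p x}) else None) = Some n
     \<longleftrightarrow> (\<exists>i < length d. d ! i = x \<and> Suc i = n)"
proof (cases "x \<in> A")
  case True
  then obtain j where j: "j < length d" "d ! j = x"
    using A by (auto simp: in_set_conv_nth)
  have rank: "card {y \<in> A. p y \<le> p (d ! i)} = Suc i" if "i < length d" for i
    using card_le_nth_strictly_sorted[OF sorted that] A by simp
  have "i = j" if "i < length d" "d ! i = x" for i
    using rank[OF that(1)] rank[OF j(1)] that(2) j(2) by simp
  then have "(\<exists>i < length d. d ! i = x \<and> Suc i = n) \<longleftrightarrow> Suc j = n"
    using j by blast
  moreover have "card {y \<in> A. p y \<le> p x} = Suc j"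
    using rank[OF j(1)] unfolding j(2) .
  ultimately show ?thesis
    using True by simp
next
  case False
  then show ?thesis
    using A by auto
qed

lemma map_eq_iff_Some: "f = g \<longleftrightarrow> (\<forall>x n. f x = Some n \<longleftrightarrow> g x = Some n)"
proof
  assume *: "\<forall>x n. f x = Some n \<longleftrightarrow> g x = Some n"
  show "f = g"
  proof
    fix x
    show "f x = g x"
    proof (cases "f x")
      case None
      then have "g x \<noteq> Some n" for n
        using *[rule_format, of x n] by simp
      then have "g x = None"
        by (rule not_Some_eq[THEN iffD1, OF allI])
      with None show ?thesis
        by simp
    next
      case (Some n)
      with * have "g x = Some n"
        by blast
      with Some show ?thesis
        by simp
    qed
  qed
qed simp

lemma rank_map_eq_iff:
  fixes p :: "'a \<Rightarrow> 'b::linorder" and q :: "'a \<Rightarrow> 'c::linorder"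
  assumes d: "sorted_wrt (\<lambda>x y. p x < p y) d" "set d = A"
    and e: "sorted_wrt (\<lambda>x y. q x < q y) e" "set e = B"
  shows "(\<lambda>x. if x \<in> A then Some (card {y \<in> A. p y \<le> p x}) else None)
       = (\<lambda>x. if x \<in> B then Some (card {y \<in> B. q y \<le> q x}) else None)
     \<longleftrightarrow> d = e" (is "?D = ?E \<longleftrightarrow> _")
proof -
  have "?D = ?E \<longleftrightarrow> (\<forall>x n. ?D x = Some n \<longleftrightarrow> ?E x = Some n)"
    by (rule map_eq_iff_Some)
  also have "\<dots> \<longleftrightarrow> (\<forall>x n. (\<exists>i < length d. d ! i = x \<and> Suc i = n)
      \<longleftrightarrow> (\<exists>i < length e. e ! i = x \<and> Suc i = n))"
    by (simp only: rank_eq_Some_iff[OF d] rank_eq_Some_iff[OF e])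
  also have "\<dots> \<longleftrightarrow> d = e"
  proof
    assume *: "\<forall>x n. (\<exists>i < length d. d ! i = x \<and> Suc i = n)
      \<longleftrightarrow> (\<exists>i < length e. e ! i = x \<and> Suc i = n)"
    have nth: "i < length d \<and> d ! i = x \<longleftrightarrow> i < length e \<and> e ! i = x" for i x
      using *[rule_format, of x "Suc i"] by auto
    then have "i < length d \<longleftrightarrow> i < length e" for i
      by blast
    then have "length d = length e"
      \<comment> \<open>If the lengths differed, the smaller one would be an index of one list
        only.\<close>
      by (meson linorder_neqE_nat less_irrefl)
    then show "d = e"
      by (rule nth_equalityI) (use nth in blast)
  qed simp
  finally show ?thesis .
qed

section \<open>Positions of first and last occurrences\<close>

lemma first_pos_less_length: "x \<in> set w \<Longrightarrow> first_pos w x < length w"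
  using Min_in[of "{i. i < length w \<and> w ! i = x}"]
  by (auto simp: first_pos_def in_set_conv_nth)

lemma first_pos_append: "x \<in> set w \<Longrightarrow> first_pos (w @ w') x = first_pos w x"
proof -
  assume x: "x \<in> set w"
  let ?A = "{i. i < length w \<and> w ! i = x}"
  have "?A \<noteq> {}"
    using x by (auto simp: in_set_conv_nth)
  then have "Min ?A \<in> ?A"
    by (intro Min_in) auto
  then show ?thesis
    unfolding first_pos_def
    by (intro Min_eqI) (auto simp: nth_append not_less split: if_splits)
qed

lemma first_pos_snoc_new: "x \<notin> set w \<Longrightarrow> first_pos (w @ [x]) x = length w"
  unfolding first_pos_def by (intro Min_eqI) (auto simp: nth_append split: if_splits)

lemma last_pos_Cons:
  assumes "x \<in> set w"
  shows "last_pos (a # w) x = Suc (last_pos w x)"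
proof -
  let ?A = "{i. i < length w \<and> w ! i = x}"
  have "?A \<noteq> {}"
    using assms by (auto simp: in_set_conv_nth)
  then have "Max ?A \<in> ?A"
    by (intro Max_in) auto
  then show ?thesis
    unfolding last_pos_def
    by (intro Max_eqI) (auto simp: nth_Cons split: nat.splits)
qed

lemma last_pos_Cons_new: "x \<notin> set w \<Longrightarrow> last_pos (x # w) x = 0"
  unfolding last_pos_def by (intro Max_eqI) (auto simp: nth_Cons split: nat.splits)

text \<open>\<open>remdups\<close> keeps the last copy of each letter. Prepending \<open>a\<close>
  shifts all earlier last positions by one; if \<open>a\<close> is new, it enters at the head with
  position 0.\<close>

lemma sorted_last_pos: "sorted_wrt (\<lambda>x y. last_pos w x < last_pos w y) (remdups w)"
proof (induction w)
  case (Cons a w)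
  have "sorted_wrt (\<lambda>x y. last_pos (a # w) x < last_pos (a # w) y) (remdups w)"
    by (rule sorted_wrt_mono_rel[OF _ Cons.IH]) (simp add: last_pos_Cons)
  then show ?case
    by (simp add: last_pos_Cons last_pos_Cons_new)
qed simp

text \<open>Appending a letter leaves the first positions of the old letters unchanged, and a new
  letter gets position \<open>length w\<close>, beyond all of them; hence the induction from the
  right.\<close>

lemma sorted_first_pos:
  "sorted_wrt (\<lambda>x y. first_pos w x < first_pos w y) (rev (remdups (rev w)))"
proof (induction w rule: rev_induct)
  case (snoc a w)
  have "sorted_wrt (\<lambda>x y. first_pos (w @ [a]) x < first_pos (w @ [a]) y) (rev (remdups (rev w)))"
    by (rule sorted_wrt_mono_rel[OF _ snoc.IH]) (simp add: first_pos_append)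
  then show ?case
    by (simp add: sorted_wrt_append first_pos_append first_pos_snoc_new first_pos_less_length)
qed simp

lemma rho_last_eq_iff: "rho_last u = rho_last v \<longleftrightarrow> remdups u = remdups v"
  unfolding rho_last_def by (intro rank_map_eq_iff sorted_last_pos set_remdups)

lemma rho_first_eq_iff: "rho_first u = rho_first v \<longleftrightarrow> remdups (rev u) = remdups (rev v)"
proof -
  have "rho_first u = rho_first v \<longleftrightarrow> rev (remdups (rev u)) = rev (remdups (rev v))"
    unfolding rho_first_def by (intro rank_map_eq_iff sorted_first_pos) simp_all
  then show ?thesis
    by simp
qed

lemma balanced_iff_mset_eq:
  assumes "u \<in> lists X" "v \<in> lists X"
  shows "balanced X u v \<longleftrightarrow> mset u = mset v"
proof -
  have "count_list u x = count_list v x" if "x \<notin> X" for x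
  proof -
    have "x \<notin> set u" "x \<notin> set v"
      using assms that by auto
    then show ?thesis
      by simp
  qed
  then show ?thesis
    unfolding balanced_def multiset_eq_iff count_mset by blast
qed

section \<open>The stalactic relation on words\<close>

text \<open>Free of ranks and of the alphabet, so that it serves both for words in the variables and
  for words over the positive integers.\<close>

definition stalactic_eq :: "'a list \<Rightarrow> 'a list \<Rightarrow> bool" where
  "stalactic_eq u v \<longleftrightarrow>
     mset u = mset v \<and> remdups (rev u) = remdups (rev v) \<and> remdups u = remdups v"

lemma stalactic_eq_iff:
  assumes "u \<in> lists X" "v \<in> lists X"
  shows "stalactic_eq u v \<longleftrightarrow>
    balanced X u v \<and> rho_first u = rho_first v \<and> rho_last u = rho_last v"
  by (simp add: stalactic_eq_def balanced_iff_mset_eq[OF assms] rho_first_eq_iff rho_last_eq_iff)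

lemma mSt_cong_iff:
  "(u, v) \<in> mSt_cong \<longleftrightarrow> u \<in> lists {1..} \<and> v \<in> lists {1..} \<and> stalactic_eq u v"
  using stalactic_eq_iff[of u "{1..}" v] by (auto simp: mSt_cong_def balanced_def)

lemma remdups_append_cong:
  assumes "remdups u = remdups u'" "remdups v = remdups v'"
  shows "remdups (u @ v) = remdups (u' @ v')"
proof -
  have *: "remdups (x @ y) = remdups (remdups x @ remdups y)" for x y :: "'a list"
    unfolding remdups_append2 by (induction x) auto
  show ?thesis
    unfolding *[of u v] *[of u' v'] assms ..
qed

lemma stalactic_eq_append:
  assumes "stalactic_eq u u'" "stalactic_eq v v'"
  shows "stalactic_eq (u @ v) (u' @ v')"
  using assms by (auto simp: stalactic_eq_def intro: remdups_append_cong)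

lemma remdups_concat_map_remdups:
  "remdups (concat (map g (remdups w))) = remdups (concat (map g w))"
proof (induction w)
  case (Cons a w)
  show ?case
  proof (cases "a \<in> set w")
    case True
    \<comment> \<open>The block \<open>g a\<close> recurs later in the word, so
      \<open>remdups\<close> deletes this copy of it entirely.\<close>
    then have "set (g a) \<subseteq> set (concat (map g w))"
      by auto
    then show ?thesis
      using True Cons.IH by (simp add: remdups_append)
  next
    case False
    then show ?thesis
      using remdups_append_cong[OF refl Cons.IH] by simp
  qed
qed simp

lemma remdups_concat_map_cong:
  "remdups u = remdups v \<Longrightarrow> remdups (concat (map g u)) = remdups (concat (map g v))"
  using remdups_concat_map_remdups[of g u] remdups_concat_map_remdups[of g v] by simp

lemma stalactic_eq_concat_map:
  assumes "stalactic_eq u v"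
  shows "stalactic_eq (concat (map g u)) (concat (map g v))"
proof -
  have "mset (concat (map g w)) = (\<Sum>x\<in>#mset w. mset (g x))" for w
    by (induction w) auto
  \<comment> \<open>Reversal turns substitution by \<open>g\<close> into substitution by the
    reversed blocks, which reduces first occurrences to last occurrences.\<close>
  moreover have "rev (concat (map g w)) = concat (map (\<lambda>x. rev (g x)) (rev w))" for w
    by (induction w) auto
  ultimately show ?thesis
    using assms unfolding stalactic_eq_def
    by (auto intro: remdups_concat_map_cong)
qed

text \<open>The inverse renaming is itself a substitution, by one-letter words, so it preserves
  \<open>stalactic_eq\<close>.\<close>

lemma stalactic_eq_map_inj_on:
  assumes inj: "inj_on f (set u \<union> set v)" and eq: "stalactic_eq (map f u) (map f v)"
  shows "stalactic_eq u v"
proof -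
  let ?g = "inv_into (set u \<union> set v) f"
  have "map ?g (map f u) = u" "map ?g (map f v) = v"
    using inj by (auto intro!: map_idI)
  then have "concat (map (\<lambda>x. [?g x]) (map f u)) = u" "concat (map (\<lambda>x. [?g x]) (map f v)) = v"
    by (simp_all only: concat_map_singleton)
  then show ?thesis
    using stalactic_eq_concat_map[OF eq, of "\<lambda>x. [?g x]"] by (simp only:)
qed

section \<open>The meet-stalactic monoid\<close>

lemma equiv_mSt_cong: "equiv (lists {1..}) mSt_cong"
  by (rule equivI) (auto simp: refl_on_def sym_def trans_def mSt_cong_iff stalactic_eq_def)

lemma mSt_class_eq_iff:
  assumes "u \<in> lists {1..}" "v \<in> lists {1..}"
  shows "mSt_cong `` {u} = mSt_cong `` {v} \<longleftrightarrow> stalactic_eq u v"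
  using eq_equiv_class_iff[OF equiv_mSt_cong assms] assms by (simp add: mSt_cong_iff)

text \<open>The concatenations of members of two classes need not fill a class, but they are all
  congruent to \<open>u @ v\<close>, so closing them under the congruence gives its class.\<close>

lemma mult_mSt_class:
  assumes "u \<in> lists {1..}" "v \<in> lists {1..}"
  shows "mSt_cong `` {u} \<otimes>\<^bsub>mSt\<^esub> mSt_cong `` {v} = mSt_cong `` {u @ v}"
proof -
  let ?U = "mSt_cong `` {u} <#>\<^bsub>free_monoid {1..}\<^esub> mSt_cong `` {v}"
  have mem: "w \<in> ?U \<longleftrightarrow> (\<exists>a b. (u, a) \<in> mSt_cong \<and> (v, b) \<in> mSt_cong \<and> w = a @ b)" for w
    by (auto simp: set_mult_def free_monoid_def)
  have "(u @ v, w) \<in> mSt_cong" if "w \<in> ?U" for w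
    using that unfolding mem by (auto simp: mSt_cong_iff intro: stalactic_eq_append)
  then have "mSt_cong `` ?U \<subseteq> mSt_cong `` {u @ v}"
    using equiv_mSt_cong by (blast dest: equivE transD)
  moreover have "u @ v \<in> ?U"
    unfolding mem using assms by (auto simp: mSt_cong_iff stalactic_eq_def)
  then have "mSt_cong `` {u @ v} \<subseteq> mSt_cong `` ?U"
    by blast
  ultimately show ?thesis
    by (simp add: mSt_def quotient_monoid_def)
qed

lemma one_mSt: "\<one>\<^bsub>mSt\<^esub> = mSt_cong `` {[]}"
  by (simp add: mSt_def quotient_monoid_def free_monoid_def)

lemma carrier_mSt: "carrier mSt = lists {1..} // mSt_cong"
  by (simp add: mSt_def quotient_monoid_def free_monoid_def)

text \<open>A morphism from a free monoid is determined by its values on the letters;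
  \<open>g\<close> picks a representative of each such value.\<close>

lemma monoid_hom_mSt_lift:
  assumes \<psi>: "\<psi> \<in> monoid_homs (free_monoid X) mSt"
  obtains g where "\<And>x. g x \<in> lists {1..}"
    and "\<And>w. w \<in> lists X \<Longrightarrow> \<psi> w = mSt_cong `` {concat (map g w)}"
proof -
  have closed: "\<psi> w \<in> lists {1..} // mSt_cong" if "w \<in> lists X" for w
    using \<psi> that by (auto simp: monoid_homs_def hom_def free_monoid_def carrier_mSt)
  have mult: "\<psi> (w @ w') = \<psi> w \<otimes>\<^bsub>mSt\<^esub> \<psi> w'" if "w \<in> lists X" "w' \<in> lists X" for w w'
    using \<psi> that by (auto simp: monoid_homs_def hom_def free_monoid_def)
  have one: "\<psi> [] = mSt_cong `` {[]}"
    using \<psi> by (simp add: monoid_homs_def one_mSt) (simp add: free_monoid_def)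
  \<comment> \<open>Outside \<open>X\<close> any word over the positive integers will do; this makes
    \<open>g\<close> total.\<close>
  have "\<forall>x. \<exists>a. a \<in> lists {1..} \<and> (x \<in> X \<longrightarrow> \<psi> [x] = mSt_cong `` {a})"
  proof
    fix x
    show "\<exists>a. a \<in> lists {1..} \<and> (x \<in> X \<longrightarrow> \<psi> [x] = mSt_cong `` {a})"
      using closed[of "[x]"] by (cases "x \<in> X") (auto elim!: quotientE)
  qed
  then obtain g where g: "\<And>x. g x \<in> lists {1..}"
      "\<And>x. x \<in> X \<Longrightarrow> \<psi> [x] = mSt_cong `` {g x}"
    by metis
  have "\<psi> w = mSt_cong `` {concat (map g w)}" if "w \<in> lists X" for w
    using that
  proof (induction w)
    case Nil
    then show ?case
      using one by simp
  next
    case (Cons x w)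
    have "concat (map g w) \<in> lists {1..}"
      using g(1) by fastforce
    then show ?case
      using mult[of "[x]" w] Cons g by (simp add: mult_mSt_class)
  qed
  with g(1) show thesis
    by (rule that)
qed

lemma map_class_monoid_hom:
  assumes "\<And>x. f x \<in> {1..}"
  shows "(\<lambda>w. mSt_cong `` {map f w}) \<in> monoid_homs (free_monoid X) mSt"
proof -
  have "map f w \<in> lists {1..}" for w
    using assms by auto
  then show ?thesis
    unfolding monoid_homs_def hom_def
    by (simp add: one_mSt carrier_mSt mult_mSt_class quotientI) (simp add: free_monoid_def mult_mSt_class quotientI)
qed

section \<open>Identities satisfied by the meet-stalactic monoid\<close>

theorem corollary7p5:
  fixes X :: "'x set" and u v :: "'x list"
  assumes "u \<in> lists X" and "v \<in> lists X"
  shows "satisfies_identity mSt X u v \<longleftrightarrow>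
    balanced X u v \<and> rho_first u = rho_first v \<and> rho_last u = rho_last v"
proof -
  have "satisfies_identity mSt X u v \<longleftrightarrow> stalactic_eq u v"
  proof
    assume sat: "satisfies_identity mSt X u v"
    \<comment> \<open>The alphabet may be uncountable, so injectivity is sought only on the finitely
      many variables of \<open>u\<close> and \<open>v\<close>.\<close>
    obtain h :: "'x \<Rightarrow> nat" where h: "inj_on h (set u \<union> set v)"
      using finite_imp_inj_to_nat_seg[of "set u \<union> set v"] by auto
    \<comment> \<open>\<open>Suc\<close> avoids the value 0, which is not a letter of the monoid's
      alphabet.\<close>
    define f where "f = Suc \<circ> h"
    have inj: "inj_on f (set u \<union> set v)"
      unfolding f_def using h by (simp add: comp_inj_on)
    have "mSt_cong `` {map f u} = mSt_cong `` {map f v}"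
      using sat map_class_monoid_hom[of f X] by (auto simp: satisfies_identity_def f_def)
    moreover have "map f w \<in> lists {1..}" for w
      by (auto simp: f_def)
    ultimately have "stalactic_eq (map f u) (map f v)"
      by (simp only: mSt_class_eq_iff)
    with inj show "stalactic_eq u v"
      by (rule stalactic_eq_map_inj_on)
  next
    assume eq: "stalactic_eq u v"
    show "satisfies_identity mSt X u v"
      unfolding satisfies_identity_def
    proof
      fix \<psi> assume "\<psi> \<in> monoid_homs (free_monoid X) mSt"
      then obtain g where g: "\<And>x. g x \<in> lists {1..}"
        and \<psi>: "\<And>w. w \<in> lists X \<Longrightarrow> \<psi> w = mSt_cong `` {concat (map g w)}"
        by (rule monoid_hom_mSt_lift) blast
      have "concat (map g w) \<in> lists {1..}" for w
        using g by fastforce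
      then show "\<psi> u = \<psi> v"
        using stalactic_eq_concat_map[OF eq] by (simp only: \<psi> assms mSt_class_eq_iff)
    qed
  qed
  then show ?thesis
    by (simp only: stalactic_eq_iff[OF assms])
qed

end
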